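(* Let $a<b$ be real numbers, $d\ge 1$ an integer, $1<p<\infty$ with conjugate exponent $p'$, and $0<\alpha<1$. Let $L:(\mathbb{R}^d)^4\times[a,b]\to\mathbb{R}$ be of class $C^1$. If there exist $P_0\in\mathscr{P}_1$, $P_1\in\mathscr{P}_1$, $P_2\in\mathscr{P}_{p'}$, $P_3\in\mathscr{P}_{p'}$ and $P_4\in\mathscr{P}_{p'}$ such that for all $(x_1,x_2,x_3,x_4,t)\in(\mathbb{R}^d)^4\times[a,b]$ $$|L(x_1,x_2,x_3,x_4,t)|\le P_0(x_1,x_2,x_3,x_4,t)$$ and $$\|\partial_iL(x_1,x_2,x_3,x_4,t)\|\le P_i(x_1,x_2,x_3,x_4,t)\qquad\text{for } i=1,2,3,4,$$ then $L$ is regular.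
   Context: $L^r=L^r(a,b;\mathbb{R}^d)$ and $W^{1,r}=W^{1,r}(a,b;\mathbb{R}^d)$ are the usual Lebesgue and Sobolev spaces (for scalar-valued functions, the notation $L^r$ means $L^r(a,b;\mathbb{R})$). Elements of $W^{1,p}$ are identified with their continuous representatives, and $\dot u$ denotes the derivative of $u$. $\|\cdot\|$ is the Euclidean norm on $\mathbb{R}^d$, $\mathbb{R}^+=[0,\infty)$, and $\partial_i L$ is the partial derivative (gradient) of $L$ with respect to its $i$th argument. For $\beta>0$ and $f\in L^1$, the left Riemann--Liouville fractional integral is $I^{\beta}_{-}[f](t)=\frac{1}{\Gamma(\beta)}\int_a^t (t-y)^{\beta-1}f(y)\,dy$ (defined for a.e. $t\in(a,b)$). For $0<\alpha<1$ and $f\in W^{1,1}$, the left Caputo fractional derivative is ${}_{c}D^{\alpha}_{-}[f]=I^{1-\alpha}_{-}[\dot f]$. For $M\ge1$, $\mathscr{P}_M$ is the set of maps $P:(\mathbb{R}^d)^4\times[a,b]\to\mathbb{R}^+$ of the form $$P(x_1,x_2,x_3,x_4,t)=\sum_{k=0}^{N}c_k(x_1,t)\,\|x_2\|^{d_{2,k}}\|x_3\|^{d_{3,k}}\|x_4\|^{d_{4,k}},$$ where $N\in\mathbb{N}$ and, for each $k=0,\dots,N$, $c_k:\mathbb{R}^d\times[a,b]\to\mathbb{R}^+$ is continuous and $d_{2,k},d_{3,k},d_{4,k}\ge0$ are real numbers with $d_{2,k}+d_{3,k}+d_{4,k}\le p/M$ (with the convention $s^0=1$ for all $s\ge 0$).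 $L$ is called regular if for every $u\in W^{1,p}$ the following functions of $t$, all evaluated at $(u,I^{\alpha}_{-}[u],\dot u,{}_{c}D^{\alpha}_{-}[u],t)$, satisfy: $L\in L^1$, $\partial_1L\in L^1$, $\partial_2L\in L^{p'}$, $\partial_3L\in L^{p'}$, $\partial_4L\in L^{p'}$. *)

theory Defs
  imports "HOL-Analysis.Analysis"
begin
text \<open>Spaces of functions, not of equivalence classes. Membership is invariant under changes
  on null sets, and values outside the open interval are irrelevant.\<close>

definition Lr :: "real \<Rightarrow> real \<Rightarrow> real \<Rightarrow> (real \<Rightarrow> 'e::euclidean_space) set" where
  "Lr a b r = {f. f \<in> borel_measurable (lebesgue_on {a<..<b}) \<and>
     integrable (lebesgue_on {a<..<b}) (\<lambda>t. norm (f t) powr r)}"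

definition conj_exponent :: "real \<Rightarrow> real" where
  "conj_exponent p = p / (p - 1)"

definition test_function :: "real \<Rightarrow> real \<Rightarrow> (real \<Rightarrow> real) \<Rightarrow> bool" where
  "test_function a b \<phi> \<longleftrightarrow>
     (\<forall>n x. (deriv ^^ n) \<phi> field_differentiable at x) \<and>
     (\<exists>K. compact K \<and> K \<subseteq> {a<..<b} \<and> (\<forall>x. x \<notin> K \<longrightarrow> \<phi> x = 0))"

definition weak_derivative ::
    "real \<Rightarrow> real \<Rightarrow> (real \<Rightarrow> 'e::euclidean_space) \<Rightarrow> (real \<Rightarrow> 'e) \<Rightarrow> bool" where
  "weak_derivative a b u v \<longleftrightarrow> u \<in> Lr a b 1 \<and> v \<in> Lr a b 1 \<and>
     (\<forall>\<phi>. test_function a b \<phi> \<longrightarrow>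
        (LINT t|lebesgue_on {a<..<b}. deriv \<phi> t *\<^sub>R u t) =
        - (LINT t|lebesgue_on {a<..<b}. \<phi> t *\<^sub>R v t))"

text \<open>The requirement of continuity selects the continuous representative on \<open>[a, b]\<close>.\<close>

definition W1 :: "real \<Rightarrow> real \<Rightarrow> real \<Rightarrow> (real \<Rightarrow> 'e::euclidean_space) set" where
  "W1 a b p = {u. continuous_on {a..b} u \<and> u \<in> Lr a b p \<and>
     (\<exists>v \<in> Lr a b p. weak_derivative a b u v)}"

definition RL_integral :: "real \<Rightarrow> real \<Rightarrow> (real \<Rightarrow> 'e::euclidean_space) \<Rightarrow> real \<Rightarrow> 'e" where
  "RL_integral a \<beta> f t =
     (1 / Gamma \<beta>) *\<^sub>R (LINT y|lebesgue_on {a<..<t}. ((t - y) powr (\<beta> - 1)) *\<^sub>R f y)"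

text \<open>The Caputo derivative of a function \<open>f\<close> depends on \<open>f\<close> only through its weak derivative,
  which is determined up to a null set. The argument \<open>f'\<close> is a representative of that weak
  derivative; the choice does not affect the value.\<close>

definition caputo_derivative ::
    "real \<Rightarrow> real \<Rightarrow> (real \<Rightarrow> 'e::euclidean_space) \<Rightarrow> real \<Rightarrow> 'e" where
  "caputo_derivative a \<alpha> f' = RL_integral a (1 - \<alpha>) f'"

type_synonym 'd arg = "(real^'d) \<times> (real^'d) \<times> (real^'d) \<times> (real^'d) \<times> real"

text \<open>\<open>C1_on\<close> uses the Frechet derivative relative to the set, so on
  \<open>UNIV \<times> \<dots> \<times> {a..b}\<close> the derivative in the last variable is one-sided
  at the end points.\<close>

definition C1_on :: "('x::euclidean_space \<Rightarrow> real) \<Rightarrow> 'x set \<Rightarrow> bool" where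
  "C1_on f S \<longleftrightarrow> (\<exists>f' :: 'x \<Rightarrow> 'x \<Rightarrow>\<^sub>L real.
     (\<forall>z\<in>S. (f has_derivative blinfun_apply (f' z)) (at z within S)) \<and> continuous_on S f')"

definition gradient :: "('v::real_inner \<Rightarrow> real) \<Rightarrow> 'v \<Rightarrow> 'v" where
  "gradient f x = (THE g. GDERIV f x :> g)"

fun partial1 :: "('d::finite arg \<Rightarrow> real) \<Rightarrow> 'd arg \<Rightarrow> real^'d" where
  "partial1 L (x1, x2, x3, x4, t) = gradient (\<lambda>x. L (x, x2, x3, x4, t)) x1"

fun partial2 :: "('d::finite arg \<Rightarrow> real) \<Rightarrow> 'd arg \<Rightarrow> real^'d" where
  "partial2 L (x1, x2, x3, x4, t) = gradient (\<lambda>x. L (x1, x, x3, x4, t)) x2"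

fun partial3 :: "('d::finite arg \<Rightarrow> real) \<Rightarrow> 'd arg \<Rightarrow> real^'d" where
  "partial3 L (x1, x2, x3, x4, t) = gradient (\<lambda>x. L (x1, x2, x, x4, t)) x3"

fun partial4 :: "('d::finite arg \<Rightarrow> real) \<Rightarrow> 'd arg \<Rightarrow> real^'d" where
  "partial4 L (x1, x2, x3, x4, t) = gradient (\<lambda>x. L (x1, x2, x3, x, t)) x4"

text \<open>Real power with \<open>s\<^sup>0 = 1\<close> also for \<open>s = 0\<close>; the library has \<open>0 powr 0 = 0\<close>.\<close>

definition rpow :: "real \<Rightarrow> real \<Rightarrow> real" where
  "rpow s r = (if r = 0 then 1 else s powr r)"

text \<open>Here \<open>p\<close> is the ambient integrability exponent; members are constrained only
  for \<open>t\<close> in \<open>[a, b]\<close>.\<close>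

definition poly_class :: "real \<Rightarrow> real \<Rightarrow> real \<Rightarrow> real \<Rightarrow> ('d::finite arg \<Rightarrow> real) set" where
  "poly_class a b p M = {P. \<exists>(N::nat) (c :: nat \<Rightarrow> (real^'d) \<times> real \<Rightarrow> real)
       (d2 :: nat \<Rightarrow> real) (d3 :: nat \<Rightarrow> real) (d4 :: nat \<Rightarrow> real).
     (\<forall>k\<le>N. continuous_on (UNIV \<times> {a..b}) (c k) \<and>
        (\<forall>x. \<forall>t\<in>{a..b}. 0 \<le> c k (x, t)) \<and>
        0 \<le> d2 k \<and> 0 \<le> d3 k \<and> 0 \<le> d4 k \<and> d2 k + d3 k + d4 k \<le> p / M) \<and>
     (\<forall>x1 x2 x3 x4. \<forall>t\<in>{a..b}. P (x1, x2, x3, x4, t) =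
        (\<Sum>k\<le>N. c k (x1, t) * rpow (norm x2) (d2 k) * rpow (norm x3) (d3 k)
                             * rpow (norm x4) (d4 k)))}"

definition frac_args ::
    "real \<Rightarrow> real \<Rightarrow> (real \<Rightarrow> real^'d) \<Rightarrow> (real \<Rightarrow> real^'d) \<Rightarrow> real \<Rightarrow> 'd::finite arg" where
  "frac_args a \<alpha> u v t =
     (u t, RL_integral a \<alpha> u t, v t, caputo_derivative a \<alpha> v t, t)"

text \<open>\<open>v\<close> ranges over all representatives of the derivative of \<open>u\<close>.\<close>

definition regular_lagrangian ::
    "real \<Rightarrow> real \<Rightarrow> real \<Rightarrow> real \<Rightarrow> ('d::finite arg \<Rightarrow> real) \<Rightarrow> bool" where
  "regular_lagrangian a b p \<alpha> L \<longleftrightarrow>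
     (\<forall>u \<in> W1 a b p. \<forall>v \<in> Lr a b p. weak_derivative a b u v \<longrightarrow>
        (\<lambda>t. L (frac_args a \<alpha> u v t)) \<in> Lr a b 1 \<and>
        (\<lambda>t. partial1 L (frac_args a \<alpha> u v t)) \<in> Lr a b 1 \<and>
        (\<lambda>t. partial2 L (frac_args a \<alpha> u v t)) \<in> Lr a b (conj_exponent p) \<and>
        (\<lambda>t. partial3 L (frac_args a \<alpha> u v t)) \<in> Lr a b (conj_exponent p) \<and>
        (\<lambda>t. partial4 L (frac_args a \<alpha> u v t)) \<in> Lr a b (conj_exponent p))"

end

theory Submission
  imports Defs
begin

text \<open>
  On bounded intervals the fractional integrals of positive order map \<open>L\<^sup>p\<close> into itself: they are
  convolutions with an integrable kernel, so Young's inequality applies. Hence \<open>I\<^sup>\<alpha>[u]\<close>, \<open>u'\<close> and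
  the Caputo derivative all lie in \<open>L\<^sup>p\<close>. Since \<open>u\<close> has compact range, a member of
  \<open>poly_class a b p M\<close> along \<open>u\<close> is at most a constant times the power \<open>p / M\<close> of
  one plus the sum of the norms of these three functions, so its \<open>M\<close>-th power is integrable.
\<close>

section \<open>Convolution with an integrable kernel preserves p-integrability\<close>

text \<open>The left-hand side is the tangent at \<open>l\<close> to the convex function
  \<open>s powr p\<close>. The bound is Young's inequality for the product of \<open>s\<close> and
  \<open>l powr (p - 1)\<close> with exponents \<open>p\<close> and \<open>p / (p - 1)\<close>,
  which includes the boundary cases \<open>s = 0\<close> and \<open>l = 0\<close>.\<close>

lemma powr_above_tangent:
  fixes s l p :: real
  assumes "1 < p" "0 \<le> s" "0 \<le> l"
  shows "p * l powr (p - 1) * s - (p - 1) * l powr p \<le> s powr p"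
proof -
  have q: "1 < p / (p - 1)" "1 / p + 1 / (p / (p - 1)) = 1"
    using assms by (simp_all add: field_simps)
  have "s * l powr (p - 1) \<le> s powr p / p + (l powr (p - 1)) powr (p / (p - 1)) / (p / (p - 1))"
    by (rule Youngs_inequality) (use assms q in auto)
  also have "(l powr (p - 1)) powr (p / (p - 1)) = l powr p"
    using assms by (simp add: powr_powr)
  finally show ?thesis
    using assms by (simp add: field_simps)
qed

text \<open>Jensen's inequality for the measure with density \<open>k\<close>: integrate the tangent bound above at
  \<open>l = (\<integral>x. k x * norm (f x) \<partial>M) / C\<close>. Dividing by an upper bound \<open>C\<close> rather than by the
  mass of \<open>k\<close> avoids the case of zero mass.\<close>

lemma integral_powr_le:
  fixes f :: "'a \<Rightarrow> 'e::euclidean_space"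
  assumes p: "1 < p" and k: "integrable M k" "\<And>x. 0 \<le> k x"
    and C: "(\<integral>x. k x \<partial>M) \<le> C" "0 < C"
    and f: "f \<in> borel_measurable M"
  shows "ennreal (norm (\<integral>x. k x *\<^sub>R f x \<partial>M) powr p)
    \<le> ennreal (C powr (p - 1)) * (\<integral>\<^sup>+x. ennreal (k x * norm (f x) powr p) \<partial>M)"
proof (cases "(\<integral>\<^sup>+x. ennreal (k x * norm (f x) powr p) \<partial>M) = \<infinity>")
  case True
  then show ?thesis
    using C by (simp add: ennreal_mult_top)
next
  case False
  note [measurable] = f borel_measurable_integrable[OF k(1)]
  have A: "integrable M (\<lambda>x. k x * norm (f x) powr p)"
    using False k(2) by (intro integrableI_nonneg) (auto simp: less_top)
  \<comment> \<open>As \<open>k\<close> is integrable, this bound passes integrability from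
    \<open>k x * norm (f x) powr p\<close> to \<open>k x * norm (f x)\<close>.\<close>
  have le: "s \<le> 1 + s powr p" if "0 \<le> s" for s :: real
  proof (cases "s \<le> 1")
    case False
    with p have "s powr 1 \<le> s powr p" by (intro powr_mono) auto
    with False show ?thesis by simp
  qed (simp add: add_increasing2)
  have B: "integrable M (\<lambda>x. k x * norm (f x))"
  proof (rule Bochner_Integration.integrable_bound)
    show "integrable M (\<lambda>x. k x + k x * norm (f x) powr p)"
      using k(1) A by simp
    have "norm (k x * norm (f x)) \<le> norm (k x + k x * norm (f x) powr p)" for x
      using mult_left_mono[OF le[of "norm (f x)"] k(2)[of x]] k(2)[of x] by (simp add: algebra_simps)
    then show "AE x in M. norm (k x * norm (f x)) \<le> norm (k x + k x * norm (f x) powr p)"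
      by simp
  qed measurable
  define m where "m = (\<integral>x. k x * norm (f x) \<partial>M)"
  have m0: "0 \<le> m" unfolding m_def using k(2) by simp
  define l where "l = m / C"
  have l0: "0 \<le> l" and m_eq: "m = C * l" using m0 C by (simp_all add: l_def)
  let ?A = "\<integral>x. k x * norm (f x) powr p \<partial>M"
  have "(\<integral>x. p * l powr (p - 1) * (k x * norm (f x)) - (p - 1) * l powr p * k x \<partial>M) \<le> ?A"
  proof (rule integral_mono)
    show "p * l powr (p - 1) * (k x * norm (f x)) - (p - 1) * l powr p * k x
        \<le> k x * norm (f x) powr p" for x
      using mult_left_mono[OF powr_above_tangent[OF p norm_ge_zero[of "f x"] l0] k(2)[of x]]
      by (simp add: algebra_simps)
  qed (use A B k(1) in simp_all)
  also have "(\<integral>x. p * l powr (p - 1) * (k x * norm (f x)) - (p - 1) * l powr p * k x \<partial>M)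
      = p * l powr (p - 1) * m - (p - 1) * l powr p * (\<integral>x. k x \<partial>M)"
    using B k(1) by (simp add: m_def)
  finally have 1: "p * l powr (p - 1) * m - (p - 1) * l powr p * (\<integral>x. k x \<partial>M) \<le> ?A" .
  \<comment> \<open>With \<open>m = C * l\<close>, replacing the mass of \<open>k\<close> in the
    subtracted term by the upper bound \<open>C\<close> leaves \<open>C * l powr p\<close> on the
    left of the tangent bound; times \<open>C powr (p - 1)\<close> this is
    \<open>m powr p\<close>.\<close>
  have "l powr (p - 1) * l = l powr p"
    using l0 powr_mult_base[of l "p - 1"] by (simp add: mult.commute)
  then have "p * l powr (p - 1) * m = p * C * l powr p"
    by (simp add: m_eq algebra_simps)
  moreover have "(p - 1) * l powr p * (\<integral>x. k x \<partial>M) \<le> (p - 1) * l powr p * C"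
    using C(1) p by (intro mult_left_mono) auto
  moreover have "(p - 1) * l powr p * C = p * C * l powr p - C * l powr p"
    by (simp add: algebra_simps)
  ultimately have "C * l powr p \<le> ?A"
    using 1 by linarith
  then have "C powr (p - 1) * (C * l powr p) \<le> C powr (p - 1) * ?A"
    by (intro mult_left_mono) auto
  moreover have "m powr p = C powr (p - 1) * (C * l powr p)"
    using C l0 powr_mult_base[of C "p - 1"] by (simp add: m_eq powr_mult mult.assoc mult.commute)
  ultimately have m: "m powr p \<le> C powr (p - 1) * ?A" by simp
  have "norm (\<integral>x. k x *\<^sub>R f x \<partial>M) \<le> m"
    using integral_norm_bound[of M "\<lambda>x. k x *\<^sub>R f x"] k(2) by (simp add: m_def)
  then have "norm (\<integral>x. k x *\<^sub>R f x \<partial>M) powr p \<le> C powr (p - 1) * ?A"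
    using p m by (meson norm_ge_zero order_trans powr_mono2 less_imp_le zero_less_one less_trans)
  then have "ennreal (norm (\<integral>x. k x *\<^sub>R f x \<partial>M) powr p) \<le> ennreal (C powr (p - 1) * ?A)"
    by (rule ennreal_leI)
  also have "\<dots> = ennreal (C powr (p - 1)) * (\<integral>\<^sup>+x. ennreal (k x * norm (f x) powr p) \<partial>M)"
    using A k(2) by (subst nn_integral_eq_integral) (auto simp: ennreal_mult')
  finally show ?thesis .
qed

text \<open>Qualitative form of Young's convolution inequality. Jensen's inequality with the density
  \<open>k (t - y)\<close> in \<open>y\<close> bounds the integrand at each \<open>t\<close>;
  Tonelli's theorem and translation invariance turn the integral of that bound into a constant times
  the integrals of \<open>k\<close> and of \<open>norm (g y) powr p\<close>.\<close>

lemma integrable_convolution_powr: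
  fixes g :: "real \<Rightarrow> 'e::euclidean_space"
  assumes p: "1 < p" and k: "integrable lborel k" "\<And>x. 0 \<le> k x"
    and g: "g \<in> borel_measurable borel" "integrable lborel (\<lambda>y. norm (g y) powr p)"
  shows "integrable lborel (\<lambda>t. norm (\<integral>y. k (t - y) *\<^sub>R g y \<partial>lborel) powr p)"
proof -
  have km [measurable]: "k \<in> borel_measurable borel"
    using borel_measurable_integrable[OF k(1)] by simp
  note [measurable] = g(1)
  \<comment> \<open>The added 1 makes \<open>C\<close> positive even if \<open>k\<close> vanishes
    almost everywhere.\<close>
  define C where "C = (\<integral>x. k x \<partial>lborel) + 1"
  have C: "(\<integral>x. k x \<partial>lborel) \<le> C" "0 < C"
    using Bochner_Integration.integral_nonneg[of lborel k] k(2) by (auto simp: C_def add_nonneg_pos)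
  have G: "(\<integral>\<^sup>+y. ennreal (norm (g y) powr p) \<partial>lborel) < \<infinity>"
    using g(2) by (auto simp: integrable_iff_bounded)
  have K: "(\<integral>\<^sup>+t. ennreal (k t) \<partial>lborel) < \<infinity>"
    using k by (auto simp: integrable_iff_bounded)
  \<comment> \<open>This holds at every \<open>t\<close>: where the integral on the right diverges
    it is trivial, so convergence of the convolution need not be established first.\<close>
  have bound: "ennreal (norm (\<integral>y. k (t - y) *\<^sub>R g y \<partial>lborel) powr p)
      \<le> ennreal (C powr (p - 1)) * (\<integral>\<^sup>+y. ennreal (k (t - y) * norm (g y) powr p) \<partial>lborel)" for t
  proof (rule integral_powr_le)
    show "integrable lborel (\<lambda>y. k (t - y))"
      using lborel_integrable_real_affine[OF k(1), of "-1" t] by simp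
    show "(\<integral>y. k (t - y) \<partial>lborel) \<le> C"
      using C lborel_integral_real_affine[of "-1" k t] by simp
  qed (use p k C in auto)
  have "(\<integral>\<^sup>+t. ennreal (norm (\<integral>y. k (t - y) *\<^sub>R g y \<partial>lborel) powr p) \<partial>lborel)
      \<le> (\<integral>\<^sup>+t. ennreal (C powr (p - 1)) *
            (\<integral>\<^sup>+y. ennreal (k (t - y) * norm (g y) powr p) \<partial>lborel) \<partial>lborel)"
    by (intro nn_integral_mono bound)
  also have "\<dots> = ennreal (C powr (p - 1)) *
      (\<integral>\<^sup>+t. (\<integral>\<^sup>+y. ennreal (k (t - y) * norm (g y) powr p) \<partial>lborel) \<partial>lborel)"
    by (rule nn_integral_cmult) measurable
  also have "(\<integral>\<^sup>+t. (\<integral>\<^sup>+y. ennreal (k (t - y) * norm (g y) powr p) \<partial>lborel) \<partial>lborel)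
      = (\<integral>\<^sup>+y. (\<integral>\<^sup>+t. ennreal (k (t - y) * norm (g y) powr p) \<partial>lborel) \<partial>lborel)"
    by (rule lborel_pair.Fubini'[symmetric]) measurable
  also have "\<dots> = (\<integral>\<^sup>+y. (\<integral>\<^sup>+t. ennreal (k t) \<partial>lborel) * ennreal (norm (g y) powr p) \<partial>lborel)"
  proof (rule nn_integral_cong)
    fix y :: real
    have "(\<integral>\<^sup>+t. ennreal (k (t - y) * norm (g y) powr p) \<partial>lborel)
        = (\<integral>\<^sup>+t. ennreal (k (t - y)) \<partial>lborel) * ennreal (norm (g y) powr p)"
      by (subst nn_integral_multc[symmetric]) (auto simp: ennreal_mult k(2))
    also have "(\<integral>\<^sup>+t. ennreal (k (t - y)) \<partial>lborel) = (\<integral>\<^sup>+t. ennreal (k t) \<partial>lborel)"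
      using nn_integral_real_affine[of "\<lambda>x. ennreal (k x)" 1 "- y"] by simp
    finally show "(\<integral>\<^sup>+t. ennreal (k (t - y) * norm (g y) powr p) \<partial>lborel)
        = (\<integral>\<^sup>+t. ennreal (k t) \<partial>lborel) * ennreal (norm (g y) powr p)" .
  qed
  also have "\<dots> = (\<integral>\<^sup>+t. ennreal (k t) \<partial>lborel) * (\<integral>\<^sup>+y. ennreal (norm (g y) powr p) \<partial>lborel)"
    by (rule nn_integral_cmult) measurable
  also have "ennreal (C powr (p - 1)) * \<dots> < \<infinity>"
    using G K by (simp add: ennreal_mult_less_top)
  finally show ?thesis
    by (intro integrableI_nonneg) auto
qed

section \<open>Fractional integrals as convolutions\<close>

text \<open>The real-valued statement applies to each coordinate, and the finitely many exceptional
  null sets unite to one.\<close>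

lemma completion_ex_borel_measurable_euclidean:
  fixes f :: "'a \<Rightarrow> 'e::euclidean_space"
  assumes "f \<in> borel_measurable (completion M)"
  shows "\<exists>g\<in>borel_measurable M. AE x in M. f x = g x"
proof -
  have "\<exists>g\<in>borel_measurable M. AE x in M. f x \<bullet> i = g x" for i
    using assms by (intro completion_ex_borel_measurable_real) simp
  then obtain g where g: "\<And>i. g i \<in> borel_measurable M" "\<And>i. AE x in M. f x \<bullet> i = g i x"
    by metis
  have "AE x in M. \<forall>i\<in>Basis. f x \<bullet> i = g i x"
    using g(2) by (intro AE_finite_allI) auto
  then have "AE x in M. f x = (\<Sum>i\<in>Basis. g i x *\<^sub>R i)"
  proof eventually_elim
    case (elim x)
    have "f x = (\<Sum>i\<in>Basis. (f x \<bullet> i) *\<^sub>R i)" by (simp add: euclidean_representation)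
    also have "\<dots> = (\<Sum>i\<in>Basis. g i x *\<^sub>R i)" using elim by (intro sum.cong) auto
    finally show ?case .
  qed
  moreover have "(\<lambda>x. \<Sum>i\<in>Basis. g i x *\<^sub>R i) \<in> borel_measurable M"
    using g(1) by (intro borel_measurable_sum borel_measurable_scaleR) auto
  ultimately show ?thesis by (rule bexI)
qed

text \<open>Truncation at \<open>c\<close> removes the tail of the power, and
  \<open>-1 < \<gamma>\<close> controls the singularity at 0.\<close>

lemma integrable_indicator_powr:
  assumes "-1 < \<gamma>" "0 \<le> c"
  shows "integrable lborel (\<lambda>x::real. indicator {0..c} x * x powr \<gamma>)"
proof -
  have "set_integrable lebesgue {0..c} (\<lambda>x. x powr \<gamma>)"
    using assms by (intro nonnegative_absolutely_integrable_1 integrable_on_powr_from_0) auto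
  then show ?thesis
    by (simp add: set_integrable_def integrable_completion)
qed

text \<open>On the interval, the fractional integral is the convolution of a truncated power kernel
  with \<open>v\<close> extended by zero. Truncating at \<open>b - a\<close> loses nothing, because
  \<open>t - y < b - a\<close> whenever \<open>a < y < t < b\<close>.\<close>

lemma RL_integral_in_Lr:
  fixes v :: "real \<Rightarrow> 'e::euclidean_space"
  assumes p: "1 < p" and \<beta>: "0 < \<beta>" and ab: "a < b" and v: "v \<in> Lr a b p"
  shows "RL_integral a \<beta> v \<in> Lr a b p"
proof -
  define w where "w y = indicator {a<..<b} y *\<^sub>R v y" for y
  \<comment> \<open>Since \<open>0 powr _ = 0\<close>, the end point \<open>y = t\<close> does not contribute to the convolution.\<close>
  define k :: "real \<Rightarrow> real" where "k x = indicator {0..b - a} x * x powr (\<beta> - 1)" for x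
  have w: "w \<in> borel_measurable lebesgue"
    using v by (simp add: Lr_def w_def [abs_def] borel_measurable_restrict_space_iff)
  have wp: "integrable lebesgue (\<lambda>y. norm (w y) powr p)"
  proof -
    have "(\<lambda>y. norm (w y) powr p) = (\<lambda>y. indicator {a<..<b} y *\<^sub>R norm (v y) powr p)"
      by (auto simp: w_def indicator_def)
    moreover have "integrable lebesgue (\<lambda>y. indicator {a<..<b} y *\<^sub>R norm (v y) powr p)"
      using v by (simp add: Lr_def integrable_restrict_space)
    ultimately show ?thesis by simp
  qed
  \<comment> \<open>A Borel representative makes \<open>k (t - y) *\<^sub>R g y\<close> jointly
    measurable in \<open>t\<close> and \<open>y\<close>, as needed for Tonelli's theorem and for the
    measurability of \<open>h\<close>.\<close>
  obtain g where g [measurable]: "g \<in> borel_measurable borel" and wg: "AE y in lborel. w y = g y"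
    using completion_ex_borel_measurable_euclidean[OF w] by auto
  have wg': "AE y in lebesgue. w y = g y"
    using wg by (rule AE_completion)
  have "integrable lebesgue (\<lambda>y. norm (g y) powr p)"
  proof (rule integrable_cong_AE_imp[OF wp])
    show "AE y in lebesgue. norm (w y) powr p = norm (g y) powr p"
      using wg' by eventually_elim simp
  qed (intro measurable_completion, measurable)
  then have gp: "integrable lborel (\<lambda>y. norm (g y) powr p)"
    by (subst (asm) integrable_completion) auto
  have k [measurable]: "k \<in> borel_measurable borel" unfolding k_def [abs_def] by measurable
  have ki: "integrable lborel k" "0 \<le> k x" for x
    using integrable_indicator_powr[of "\<beta> - 1" "b - a"] \<beta> ab by (simp_all add: k_def [abs_def])
  define h where "h t = (1 / Gamma \<beta>) *\<^sub>R (\<integral>y. k (t - y) *\<^sub>R g y \<partial>lborel)" for t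
  have h [measurable]: "h \<in> borel_measurable borel"
    unfolding h_def [abs_def] by measurable
  have "integrable lborel (\<lambda>t. norm (h t) powr p)"
    using integrable_convolution_powr[OF p ki g gp] by (simp add: h_def powr_divide)
  then have "integrable lebesgue (\<lambda>t. norm (h t) powr p)"
    by (subst integrable_completion) auto
  then have hp: "integrable (lebesgue_on {a<..<b}) (\<lambda>t. norm (h t) powr p)"
    by (simp add: integrable_restrict_space integrable_mult_indicator del: real_scaleR_def)
  have hm: "h \<in> borel_measurable (lebesgue_on {a<..<b})"
    by (intro measurable_restrict_space1 measurable_completion) simp
  \<comment> \<open>Equality holds at every point of the interval, not just almost everywhere, since
    exchanging \<open>w\<close> for \<open>g\<close> alters the integrand only on a null set of
    \<open>y\<close>.\<close>
  have eq: "RL_integral a \<beta> v t = h t" if t: "t \<in> {a<..<b}" for t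
  proof -
    have "(LINT y|lebesgue_on {a<..<t}. ((t - y) powr (\<beta> - 1)) *\<^sub>R v y)
       = (LINT y|lebesgue. k (t - y) *\<^sub>R w y)"
      using t by (subst integral_restrict_space)
        (auto intro!: Bochner_Integration.integral_cong simp: k_def w_def indicator_def)
    also have "\<dots> = (LINT y|lebesgue. k (t - y) *\<^sub>R g y)"
    proof (rule integral_cong_AE)
      show "(\<lambda>y. k (t - y) *\<^sub>R w y) \<in> borel_measurable lebesgue"
        by (intro borel_measurable_scaleR w measurable_completion) measurable
      show "(\<lambda>y. k (t - y) *\<^sub>R g y) \<in> borel_measurable lebesgue"
        by (intro measurable_completion) measurable
      show "AE y in lebesgue. k (t - y) *\<^sub>R w y = k (t - y) *\<^sub>R g y"
        using wg' by eventually_elim simp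
    qed
    also have "\<dots> = (LINT y|lborel. k (t - y) *\<^sub>R g y)"
      by (rule integral_completion) measurable
    finally show ?thesis by (simp add: RL_integral_def h_def)
  qed
  have "RL_integral a \<beta> v \<in> borel_measurable (lebesgue_on {a<..<b})"
    using hm by (subst measurable_cong[where g = h]) (auto simp: eq)
  moreover have "integrable (lebesgue_on {a<..<b}) (\<lambda>t. norm (RL_integral a \<beta> v t) powr p)"
    using hp by (subst Bochner_Integration.integrable_cong[where g = "\<lambda>t. norm (h t) powr p"])
      (auto simp: eq)
  ultimately show ?thesis by (simp add: Lr_def)
qed

section \<open>Growth of the polynomial class along p-integrable functions\<close>

lemma rpow_le_powr:
  assumes "0 \<le> s" "s \<le> m" "0 \<le> d" "1 \<le> m"
  shows "rpow s d \<le> m powr d"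
  using assms by (auto simp: rpow_def intro: powr_mono2)

text \<open>Every factor is bounded by a power of the common base \<open>1 + x + y + z\<close>. The
  summand 1 keeps the base at least 1, so that the total exponent may be raised to \<open>q\<close>,
  and it covers the value 1 of \<open>rpow\<close> at exponent 0.\<close>

lemma rpow_prod_le_powr:
  assumes "0 \<le> x" "0 \<le> y" "0 \<le> z" "0 \<le> d" "0 \<le> e" "0 \<le> f" "d + e + f \<le> q"
  shows "rpow x d * rpow y e * rpow z f \<le> (1 + x + y + z) powr q"
proof -
  let ?m = "1 + x + y + z"
  have "rpow x d * rpow y e * rpow z f \<le> ?m powr d * ?m powr e * ?m powr f"
    using assms by (intro mult_mono rpow_le_powr) (auto simp: rpow_def)
  also have "\<dots> = ?m powr (d + e + f)"
    by (simp add: powr_add)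
  also have "\<dots> \<le> ?m powr q"
    using assms by (intro powr_mono) auto
  finally show ?thesis .
qed

text \<open>The continuous coefficients are bounded on the compact set
  \<open>X \<times> {a..b}\<close>, and \<open>C\<close> is the sum of their bounds. The set
  \<open>X\<close> is meant to be the range of \<open>u\<close>.\<close>

lemma poly_class_bound:
  assumes "P \<in> poly_class a b p M" and X: "compact X"
  shows "\<exists>C\<ge>0. \<forall>x1\<in>X. \<forall>x2 x3 x4. \<forall>t\<in>{a..b}.
    P (x1, x2, x3, x4, t) \<le> C * (1 + norm x2 + norm x3 + norm x4) powr (p / M)"
proof -
  obtain N :: nat and c d2 d3 d4 where
    cd: "\<forall>k\<le>N. continuous_on (UNIV \<times> {a..b}) (c k) \<and>
        (\<forall>x. \<forall>t\<in>{a..b}. 0 \<le> c k (x, t)) \<and>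
        0 \<le> d2 k \<and> 0 \<le> d3 k \<and> 0 \<le> d4 k \<and> d2 k + d3 k + d4 k \<le> p / M"
    and P: "\<forall>x1 x2 x3 x4. \<forall>t\<in>{a..b}. P (x1, x2, x3, x4, t) =
        (\<Sum>k\<le>N. c k (x1, t) * rpow (norm x2) (d2 k) * rpow (norm x3) (d3 k)
                             * rpow (norm x4) (d4 k))"
    using assms(1) unfolding poly_class_def mem_Collect_eq by (elim exE conjE)
  have c: "continuous_on (UNIV \<times> {a..b}) (c k)"
    and d: "0 \<le> d2 k \<and> 0 \<le> d3 k \<and> 0 \<le> d4 k \<and> d2 k + d3 k + d4 k \<le> p / M" if "k \<le> N" for k
    using cd that by auto
  have "\<exists>B\<ge>0. \<forall>z \<in> X \<times> {a..b}. c k z \<le> B" if "k \<le> N" for k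
  proof -
    have "compact (c k ` (X \<times> {a..b}))"
      using X
      by (intro compact_continuous_image compact_Times continuous_on_subset[OF c[OF that]]) auto
    then obtain B where "\<And>y. y \<in> c k ` (X \<times> {a..b}) \<Longrightarrow> norm y \<le> B"
      by (meson bounded_iff compact_imp_bounded)
    \<comment> \<open>The absolute value gives a nonnegative bound also when the image is
      empty.\<close>
    then show ?thesis by (intro exI[of _ "\<bar>B\<bar>"]) force
  qed
  then obtain B where B: "\<And>k. k \<le> N \<Longrightarrow> 0 \<le> B k"
    "\<And>k z. k \<le> N \<Longrightarrow> z \<in> X \<times> {a..b} \<Longrightarrow> c k z \<le> B k"
    by metis
  show ?thesis
  proof (intro exI[of _ "\<Sum>k\<le>N. B k"] conjI ballI allI)
    show "0 \<le> (\<Sum>k\<le>N. B k)" using B(1) by (intro sum_nonneg) auto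
    fix x1 x2 x3 x4 t assume xt: "x1 \<in> X" "t \<in> {a..b}"
    have "P (x1, x2, x3, x4, t) = (\<Sum>k\<le>N. c k (x1, t) * rpow (norm x2) (d2 k)
        * rpow (norm x3) (d3 k) * rpow (norm x4) (d4 k))"
      using P xt by blast
    also have "\<dots> \<le> (\<Sum>k\<le>N. B k * (1 + norm x2 + norm x3 + norm x4) powr (p / M))"
    proof (rule sum_mono)
      fix k assume "k \<in> {..N}"
      then have k: "k \<le> N" by simp
      have "rpow (norm x2) (d2 k) * rpow (norm x3) (d3 k) * rpow (norm x4) (d4 k)
          \<le> (1 + norm x2 + norm x3 + norm x4) powr (p / M)"
        using d[OF k] by (intro rpow_prod_le_powr) auto
      then have "c k (x1, t) * (rpow (norm x2) (d2 k) * rpow (norm x3) (d3 k) * rpow (norm x4) (d4 k))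
          \<le> B k * (1 + norm x2 + norm x3 + norm x4) powr (p / M)"
        using xt B(1)[OF k] B(2)[OF k] by (intro mult_mono) (auto simp: rpow_def)
      then show "c k (x1, t) * rpow (norm x2) (d2 k) * rpow (norm x3) (d3 k) * rpow (norm x4) (d4 k)
          \<le> B k * (1 + norm x2 + norm x3 + norm x4) powr (p / M)"
        by (simp add: mult.assoc)
    qed
    finally show "P (x1, x2, x3, x4, t)
        \<le> (\<Sum>k\<le>N. B k) * (1 + norm x2 + norm x3 + norm x4) powr (p / M)"
      by (simp add: sum_distrib_right)
  qed
qed

text \<open>The sum is at most four times its largest term \<open>m\<close>, and
  \<open>m powr p\<close> is one of the terms in the bracket on the right.\<close>

lemma powr_sum4_le:
  fixes x y z p :: real
  assumes "0 \<le> x" "0 \<le> y" "0 \<le> z" "0 \<le> p"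
  shows "(1 + x + y + z) powr p \<le> 4 powr p * (1 + x powr p + y powr p + z powr p)"
proof -
  define m where "m = Max {1, x, y, z}"
  have m: "1 \<le> m" "x \<le> m" "y \<le> m" "z \<le> m" by (auto simp: m_def)
  have "m \<in> {1, x, y, z}" unfolding m_def by (rule Max_in) auto
  then have le: "m powr p \<le> 1 + x powr p + y powr p + z powr p"
    by (elim insertE) (auto intro: add_nonneg_nonneg)
  have "(1 + x + y + z) powr p \<le> (4 * m) powr p"
    using assms m by (intro powr_mono2) auto
  also have "\<dots> = 4 powr p * m powr p"
    using m by (simp add: powr_mult)
  also have "\<dots> \<le> 4 powr p * (1 + x powr p + y powr p + z powr p)"
    using le by (rule mult_left_mono) simp
  finally show ?thesis .
qed

lemma Lr_of_poly_class_bound: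
  fixes f :: "real \<Rightarrow> 'e::euclidean_space" and u :: "real \<Rightarrow> real^'d::finite"
  assumes P: "P \<in> poly_class a b p M" and M: "0 < M" and p: "0 < p"
    and u: "continuous_on {a..b} u"
    and w: "w2 \<in> Lr a b p" "w3 \<in> Lr a b p" "w4 \<in> Lr a b p"
    and f: "f \<in> borel_measurable (lebesgue_on {a<..<b})"
    and le: "\<And>t. t \<in> {a<..<b} \<Longrightarrow> norm (f t) \<le> P (u t, w2 t, w3 t, w4 t, t)"
  shows "f \<in> Lr a b M"
proof -
  have "compact (u ` {a..b})" using u by (intro compact_continuous_image) auto
  from poly_class_bound[OF P this] obtain C where C: "0 \<le> C"
    "\<forall>x1\<in>u ` {a..b}. \<forall>x2 x3 x4. \<forall>t\<in>{a..b}.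
      P (x1, x2, x3, x4, t) \<le> C * (1 + norm x2 + norm x3 + norm x4) powr (p / M)"
    by blast
  let ?h = "\<lambda>t. C powr M * (4 powr p * (1 + norm (w2 t) powr p + norm (w3 t) powr p + norm (w4 t) powr p))"
  have bound: "norm (f t) powr M \<le> ?h t" if t: "t \<in> {a<..<b}" for t
  proof -
    have "norm (f t) \<le> C * (1 + norm (w2 t) + norm (w3 t) + norm (w4 t)) powr (p / M)"
      using C(2) t by (intro order_trans[OF le[OF t]]) auto
    then have "norm (f t) powr M
        \<le> (C * (1 + norm (w2 t) + norm (w3 t) + norm (w4 t)) powr (p / M)) powr M"
      using M by (intro powr_mono2) auto
    \<comment> \<open>The exponent \<open>p / M\<close> in the growth bound is what makes the
      \<open>M\<close>-th power a \<open>p\<close>-th power here.\<close>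
    also have "\<dots> = C powr M * (1 + norm (w2 t) + norm (w3 t) + norm (w4 t)) powr p"
      using M C(1) by (simp add: powr_mult powr_powr)
    also have "\<dots> \<le> ?h t"
      using p by (intro mult_left_mono powr_sum4_le) auto
    finally show ?thesis .
  qed
  \<comment> \<open>The constant summand is integrable because the interval has finite
    measure.\<close>
  have "integrable (lebesgue_on {a<..<b}) ?h"
    using w by (intro integrable_mult_right Bochner_Integration.integrable_add)
      (auto simp: Lr_def intro: finite_measure.integrable_const finite_measure_lebesgue_on)
  then have "integrable (lebesgue_on {a<..<b}) (\<lambda>t. norm (f t) powr M)"
  proof (rule Bochner_Integration.integrable_bound)
    show "(\<lambda>t. norm (f t) powr M) \<in> borel_measurable (lebesgue_on {a<..<b})"
      using f by measurable
    have "norm (norm (f t) powr M) \<le> norm (?h t)" if "t \<in> {a<..<b}" for t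
      using bound[OF that] by (simp only: real_norm_def abs_of_nonneg powr_ge_zero)
    then show "AE t in lebesgue_on {a<..<b}. norm (norm (f t) powr M) \<le> norm (?h t)"
      by (intro AE_I2) simp
  qed
  with f show ?thesis by (simp add: Lr_def)
qed

text \<open>Common form of the five membership claims: \<open>G\<close> stands for the Lagrangian or
  one of its partial gradients.\<close>

lemma Lr_compose_frac_args:
  fixes G :: "'d::finite arg \<Rightarrow> 'e::euclidean_space"
  assumes "a < b" "1 < p" "0 < \<alpha>" "\<alpha> < 1" and u: "u \<in> W1 a b p" and v: "v \<in> Lr a b p"
    and G: "continuous_on (UNIV \<times> UNIV \<times> UNIV \<times> UNIV \<times> {a..b}) G" (is "continuous_on ?S G")
    and P: "P \<in> poly_class a b p M" "0 < M"
    and le: "\<And>x1 x2 x3 x4 t. t \<in> {a..b} \<Longrightarrow> norm (G (x1, x2, x3, x4, t)) \<le> P (x1, x2, x3, x4, t)"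
  shows "(\<lambda>t. G (frac_args a \<alpha> u v t)) \<in> Lr a b M"
proof -
  have uc: "continuous_on {a..b} u" and up: "u \<in> Lr a b p" using u by (simp_all add: W1_def)
  \<comment> \<open>The Caputo derivative is a fractional integral of \<open>v\<close> of order
    \<open>1 - \<alpha>\<close>, which is positive.\<close>
  have w: "RL_integral a \<alpha> u \<in> Lr a b p" "v \<in> Lr a b p" "caputo_derivative a \<alpha> v \<in> Lr a b p"
    unfolding caputo_derivative_def using assms v up by (auto intro: RL_integral_in_Lr)
  have id: "(\<lambda>t. t) \<in> borel_measurable (lebesgue_on {a<..<b})"
    by (intro measurable_restrict_space1 measurable_completion) simp
  have "frac_args a \<alpha> u v \<in> borel_measurable (lebesgue_on {a<..<b})"
    unfolding frac_args_def [abs_def] using w up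
    by (intro borel_measurable_Pair id) (auto simp: Lr_def)
  \<comment> \<open>Continuity makes \<open>G\<close> Borel only relative to \<open>?S\<close>, so
    the arguments must be measurable as a map into \<open>?S\<close>.\<close>
  then have z: "frac_args a \<alpha> u v \<in> lebesgue_on {a<..<b} \<rightarrow>\<^sub>M restrict_space borel ?S"
    by (rule measurable_restrict_space2[rotated]) (auto simp: frac_args_def)
  show ?thesis
  proof (rule Lr_of_poly_class_bound[OF P _ uc w])
    show "(\<lambda>t. G (frac_args a \<alpha> u v t)) \<in> borel_measurable (lebesgue_on {a<..<b})"
      using z borel_measurable_continuous_on_restrict[OF G] by (rule measurable_compose)
    show "norm (G (frac_args a \<alpha> u v t))
        \<le> P (u t, RL_integral a \<alpha> u t, v t, caputo_derivative a \<alpha> v t, t)"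
      if "t \<in> {a<..<b}" for t
      unfolding frac_args_def using that by (intro le) auto
  qed (use assms in auto)
qed

section \<open>Continuity of the partial gradients\<close>

text \<open>Uniqueness of the Frechet derivative and nondegeneracy of the inner product resolve the
  \<open>THE\<close> in \<open>gradient\<close>.\<close>

lemma gradient_eqI: "GDERIV f x :> g \<Longrightarrow> gradient f x = g"
  unfolding gradient_def
proof (rule the_equality)
  fix g' assume "GDERIV f x :> g" "GDERIV f x :> g'"
  then have "(\<lambda>h. h \<bullet> g') = (\<lambda>h. h \<bullet> g)"
    unfolding gderiv_def by (rule has_derivative_unique[rotated])
  then show "g' = g" by (simp add: fun_eq_iff vector_eq_ldot)
qed

text \<open>By the chain rule the derivative is the functional \<open>D\<close> after
  \<open>E\<close>; the vector representing it by the inner product has the values at the basis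
  vectors as its coordinates.\<close>

lemma gradient_compose:
  fixes e :: "'v::euclidean_space \<Rightarrow> 'x::euclidean_space" and D :: "'x \<Rightarrow>\<^sub>L real"
  assumes f: "(f has_derivative blinfun_apply D) (at (e x) within S)"
    and e: "(e has_derivative E) (at x)" and S: "\<And>y. e y \<in> S"
  shows "gradient (\<lambda>y. f (e y)) x = (\<Sum>i\<in>Basis. D (E i) *\<^sub>R i)"
proof (rule gradient_eqI)
  interpret E: bounded_linear E using e by (rule has_derivative_bounded_linear)
  \<comment> \<open>As \<open>e\<close> never leaves \<open>S\<close>, a derivative of
    \<open>f\<close> relative to \<open>S\<close> yields an unrestricted derivative of the
    composite.\<close>
  have der: "((\<lambda>y. f (e y)) has_derivative (\<lambda>h. D (E h))) (at x)"
    by (rule has_derivative_in_compose[OF e has_derivative_subset[OF f]]) (use S in auto)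
  have "D (E h) = h \<bullet> (\<Sum>i\<in>Basis. D (E i) *\<^sub>R i)" for h
  proof -
    have "D (E h) = D (E (\<Sum>i\<in>Basis. (h \<bullet> i) *\<^sub>R i))" by (simp add: euclidean_representation)
    also have "\<dots> = h \<bullet> (\<Sum>i\<in>Basis. D (E i) *\<^sub>R i)"
      by (simp only: E.sum E.scaleR blinfun.sum_right blinfun.scaleR_right inner_sum_right
          inner_scaleR_right real_scaleR_def mult.commute)
    finally show ?thesis .
  qed
  with der show "GDERIV (\<lambda>y. f (e y)) x :> (\<Sum>i\<in>Basis. D (E i) *\<^sub>R i)"
    unfolding gderiv_def by (rule has_derivative_eq_rhs[OF _ ext])
qed

lemma C1_on_continuous_partials:
  fixes L :: "'d::finite arg \<Rightarrow> real"
  assumes "C1_on L (UNIV \<times> UNIV \<times> UNIV \<times> UNIV \<times> {a..b})" (is "C1_on L ?S")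
  shows "continuous_on ?S L" "continuous_on ?S (partial1 L)" "continuous_on ?S (partial2 L)"
    "continuous_on ?S (partial3 L)" "continuous_on ?S (partial4 L)"
proof -
  obtain f' where f': "\<And>z. z \<in> ?S \<Longrightarrow> (L has_derivative blinfun_apply (f' z)) (at z within ?S)"
    and cont: "continuous_on ?S f'"
    using assms unfolding C1_on_def by blast
  show "continuous_on ?S L" using f' by (rule has_derivative_continuous_on)
  \<comment> \<open>Each basis coefficient is an evaluation of \<open>f' z\<close> at a fixed
    vector, so continuity of \<open>f'\<close> in operator norm suffices.\<close>
  have c: "continuous_on ?S (\<lambda>z. \<Sum>i\<in>Basis. f' z (E i) *\<^sub>R i)" for E :: "real^'d \<Rightarrow> 'd arg"
    by (intro continuous_intros cont)
  have partials: "partial1 L z = (\<Sum>i\<in>Basis. f' z (i, 0, 0, 0, 0) *\<^sub>R i)"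
    "partial2 L z = (\<Sum>i\<in>Basis. f' z (0, i, 0, 0, 0) *\<^sub>R i)"
    "partial3 L z = (\<Sum>i\<in>Basis. f' z (0, 0, i, 0, 0) *\<^sub>R i)"
    "partial4 L z = (\<Sum>i\<in>Basis. f' z (0, 0, 0, i, 0) *\<^sub>R i)" if z: "z \<in> ?S" for z
  proof -
    obtain x1 x2 x3 x4 t where z_eq: "z = (x1, x2, x3, x4, t)" by (cases z) auto
    have t: "t \<in> {a..b}" using z by (simp add: z_eq)
    note der = f'[OF z, unfolded z_eq]
    \<comment> \<open>Only the last coordinate is constrained in \<open>?S\<close>, so varying a
      single space slot stays inside, even when \<open>t\<close> is an end point.\<close>
    have "((\<lambda>y. (y, x2, x3, x4, t)) has_derivative (\<lambda>h. (h, 0, 0, 0, 0))) (at x1)"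
      by (intro has_derivative_Pair has_derivative_ident has_derivative_const)
    from gradient_compose[OF der this] show "partial1 L z = (\<Sum>i\<in>Basis. f' z (i, 0, 0, 0, 0) *\<^sub>R i)"
      using t by (simp add: z_eq)
    have "((\<lambda>y. (x1, y, x3, x4, t)) has_derivative (\<lambda>h. (0, h, 0, 0, 0))) (at x2)"
      by (intro has_derivative_Pair has_derivative_ident has_derivative_const)
    from gradient_compose[OF der this] show "partial2 L z = (\<Sum>i\<in>Basis. f' z (0, i, 0, 0, 0) *\<^sub>R i)"
      using t by (simp add: z_eq)
    have "((\<lambda>y. (x1, x2, y, x4, t)) has_derivative (\<lambda>h. (0, 0, h, 0, 0))) (at x3)"
      by (intro has_derivative_Pair has_derivative_ident has_derivative_const)
    from gradient_compose[OF der this] show "partial3 L z = (\<Sum>i\<in>Basis. f' z (0, 0, i, 0, 0) *\<^sub>R i)"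
      using t by (simp add: z_eq)
    have "((\<lambda>y. (x1, x2, x3, y, t)) has_derivative (\<lambda>h. (0, 0, 0, h, 0))) (at x4)"
      by (intro has_derivative_Pair has_derivative_ident has_derivative_const)
    from gradient_compose[OF der this] show "partial4 L z = (\<Sum>i\<in>Basis. f' z (0, 0, 0, i, 0) *\<^sub>R i)"
      using t by (simp add: z_eq)
  qed
  show "continuous_on ?S (partial1 L)"
    by (rule continuous_on_eq[OF c[of "\<lambda>i. (i, 0, 0, 0, 0)"] partials(1)[symmetric]])
  show "continuous_on ?S (partial2 L)"
    by (rule continuous_on_eq[OF c[of "\<lambda>i. (0, i, 0, 0, 0)"] partials(2)[symmetric]])
  show "continuous_on ?S (partial3 L)"
    by (rule continuous_on_eq[OF c[of "\<lambda>i. (0, 0, i, 0, 0)"] partials(3)[symmetric]])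
  show "continuous_on ?S (partial4 L)"
    by (rule continuous_on_eq[OF c[of "\<lambda>i. (0, 0, 0, i, 0)"] partials(4)[symmetric]])
qed

theorem proposition3p5:
  fixes a b p \<alpha> :: real
    and L :: "'d::finite arg \<Rightarrow> real"
  assumes "a < b" and "1 < p" and "0 < \<alpha>" and "\<alpha> < 1"
    and "C1_on L (UNIV \<times> UNIV \<times> UNIV \<times> UNIV \<times> {a..b})"
    and "\<exists>P0 \<in> poly_class a b p 1. \<exists>P1 \<in> poly_class a b p 1.
         \<exists>P2 \<in> poly_class a b p (conj_exponent p). \<exists>P3 \<in> poly_class a b p (conj_exponent p).
         \<exists>P4 \<in> poly_class a b p (conj_exponent p).
         \<forall>x1 x2 x3 x4. \<forall>t\<in>{a..b}.
           \<bar>L (x1, x2, x3, x4, t)\<bar> \<le> P0 (x1, x2, x3, x4, t) \<and>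
           norm (partial1 L (x1, x2, x3, x4, t)) \<le> P1 (x1, x2, x3, x4, t) \<and>
           norm (partial2 L (x1, x2, x3, x4, t)) \<le> P2 (x1, x2, x3, x4, t) \<and>
           norm (partial3 L (x1, x2, x3, x4, t)) \<le> P3 (x1, x2, x3, x4, t) \<and>
           norm (partial4 L (x1, x2, x3, x4, t)) \<le> P4 (x1, x2, x3, x4, t)"
  shows "regular_lagrangian a b p \<alpha> L"
  unfolding regular_lagrangian_def
proof (intro ballI impI)
  fix u v :: "real \<Rightarrow> real^'d" assume u: "u \<in> W1 a b p" and v: "v \<in> Lr a b p"
  let ?z = "frac_args a \<alpha> u v" and ?q = "conj_exponent p"
  obtain P0 P1 P2 P3 P4 where P: "P0 \<in> poly_class a b p 1" "P1 \<in> poly_class a b p 1"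
      "P2 \<in> poly_class a b p ?q" "P3 \<in> poly_class a b p ?q" "P4 \<in> poly_class a b p ?q"
    and le: "\<forall>x1 x2 x3 x4. \<forall>t\<in>{a..b}.
           \<bar>L (x1, x2, x3, x4, t)\<bar> \<le> P0 (x1, x2, x3, x4, t) \<and>
           norm (partial1 L (x1, x2, x3, x4, t)) \<le> P1 (x1, x2, x3, x4, t) \<and>
           norm (partial2 L (x1, x2, x3, x4, t)) \<le> P2 (x1, x2, x3, x4, t) \<and>
           norm (partial3 L (x1, x2, x3, x4, t)) \<le> P3 (x1, x2, x3, x4, t) \<and>
           norm (partial4 L (x1, x2, x3, x4, t)) \<le> P4 (x1, x2, x3, x4, t)"
    using assms(6) by (elim bexE)
  have q: "0 < ?q" using assms(2) by (simp add: conj_exponent_def)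
  \<comment> \<open>The function, its majorant and the exponent are still free here; the five claims
    below are instances.\<close>
  note member = Lr_compose_frac_args[OF assms(1-4) u v]
  note cont = C1_on_continuous_partials[OF assms(5)]
  show "(\<lambda>t. L (?z t)) \<in> Lr a b 1 \<and> (\<lambda>t. partial1 L (?z t)) \<in> Lr a b 1 \<and>
      (\<lambda>t. partial2 L (?z t)) \<in> Lr a b ?q \<and> (\<lambda>t. partial3 L (?z t)) \<in> Lr a b ?q \<and>
      (\<lambda>t. partial4 L (?z t)) \<in> Lr a b ?q"
  proof (intro conjI)
    show "(\<lambda>t. L (?z t)) \<in> Lr a b 1"
      by (rule member[OF cont(1) P(1)]) (use le q in simp_all)
    show "(\<lambda>t. partial1 L (?z t)) \<in> Lr a b 1"
      by (rule member[OF cont(2) P(2)]) (use le q in simp_all)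
    show "(\<lambda>t. partial2 L (?z t)) \<in> Lr a b ?q"
      by (rule member[OF cont(3) P(3)]) (use le q in simp_all)
    show "(\<lambda>t. partial3 L (?z t)) \<in> Lr a b ?q"
      by (rule member[OF cont(4) P(4)]) (use le q in simp_all)
    show "(\<lambda>t. partial4 L (?z t)) \<in> Lr a b ?q"
      by (rule member[OF cont(5) P(5)]) (use le q in simp_all)
  qed
qed

end
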